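(* Let $\mathbf{L}=\langle L,\vee,\wedge,{}',0,1\rangle$ be an orthomodular lattice. Define $x+y=x\vee y$ and $x\cdot y=(x\vee y')\wedge y$ (the Sasaki projection) for $x,y\in L$. Then $\mathbf{R}(\mathbf{L})=\langle L,+,\cdot,{}',0,1\rangle$ (with $\alpha(x)=x'$) is an orthomodular near semiring.
   Context: An orthomodular lattice is an algebra $\langle L,\vee,\wedge,{}',0,1\rangle$ such that $\langle L,\vee,\wedge,0,1\rangle$ is a bounded lattice, $x\wedge x'=0$, $x\vee x'=1$, $x''=x$, $x\le y$ implies $y'\le x'$, and $x\le y$ implies $y=x\vee(y\wedge x')$. A near semiring is an algebra $\langle R,+,\cdot,0,1\rangle$ such that: (i) $\langle R,+,0\rangle$ is a commutative monoid; (ii) $x\cdot 1=x=1\cdot x$ (multiplication need not be associative or commutative); (iii) $(x+y)\cdot z=(x\cdot z)+(y\cdot z)$; (iv) $x\cdot 0=0\cdot x=0$. It is idempotent if $x+x=x$; then $x\le y$ iff $x+y=y$ defines a partial order, called the induced order. An involutive near semiring is an idempotent near semiring with a map $\alpha:R\to R$ such that $\alpha(\alpha(x))=x$, and $x\le y$ implies $\alpha(y)\le\alpha(x)$. A Łukasiewicz near semiring is an involutive near semiring satisfying the identity $\alpha(x\cdot\alpha(y))\cdot\alpha(y)=\alpha(y\cdot\alpha(x))\cdot\alpha(x)$. An orthomodular near semiring is a Łukasiewicz near semiring satisfying the identity $x=x\cdot(x+y)$. *)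

theory Defs
  imports "HOL-Library.Complemented_Lattices"
begin

text \<open>Multiplication in a near semiring is neither associative nor commutative in general, and
  only right distributivity is required. Hence the library classes of semirings do not apply.\<close>

locale near_semiring = add: comm_monoid add zero
  for add :: "'a \<Rightarrow> 'a \<Rightarrow> 'a"  (infixl \<open>\<oplus>\<close> 65)
    and mult :: "'a \<Rightarrow> 'a \<Rightarrow> 'a"  (infixl \<open>\<odot>\<close> 70)
    and zero :: 'a  (\<open>\<zero>\<close>)
    and one :: 'a  (\<open>\<one>\<close>) +
  assumes mult_one_right: "x \<odot> \<one> = x"
    and mult_one_left: "\<one> \<odot> x = x"
    and distrib_right: "(x \<oplus> y) \<odot> z = (x \<odot> z) \<oplus> (y \<odot> z)"
    and mult_zero_right: "x \<odot> \<zero> = \<zero>"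
    and mult_zero_left: "\<zero> \<odot> x = \<zero>"

locale idempotent_near_semiring = near_semiring +
  assumes add_idem: "x \<oplus> x = x"
begin

definition induced_le :: "'a \<Rightarrow> 'a \<Rightarrow> bool"  (infix \<open>\<preceq>\<close> 50)
  where "x \<preceq> y \<longleftrightarrow> x \<oplus> y = y"

sublocale induced: ordering "(\<preceq>)" "\<lambda>x y. x \<preceq> y \<and> x \<noteq> y"
proof
  show "a \<preceq> a" for a
    by (simp add: induced_le_def add_idem)
  show "a \<preceq> c" if "a \<preceq> b" "b \<preceq> c" for a b c
    using that by (metis induced_le_def add.assoc)
  show "a = b" if "a \<preceq> b" "b \<preceq> a" for a b
    using that by (metis induced_le_def add.commute)
qed simp

end

locale involutive_near_semiring = idempotent_near_semiring add mult zero one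
  for add :: "'a \<Rightarrow> 'a \<Rightarrow> 'a"  (infixl \<open>\<oplus>\<close> 65)
    and mult :: "'a \<Rightarrow> 'a \<Rightarrow> 'a"  (infixl \<open>\<odot>\<close> 70)
    and \<alpha> :: "'a \<Rightarrow> 'a"
    and zero :: 'a  (\<open>\<zero>\<close>)
    and one :: 'a  (\<open>\<one>\<close>) +
  assumes invol: "\<alpha> (\<alpha> x) = x"
    and invol_antimono: "x \<preceq> y \<Longrightarrow> \<alpha> y \<preceq> \<alpha> x"

locale lukasiewicz_near_semiring = involutive_near_semiring +
  assumes lukasiewicz: "\<alpha> (x \<odot> \<alpha> y) \<odot> \<alpha> y = \<alpha> (y \<odot> \<alpha> x) \<odot> \<alpha> x"

locale orthomodular_near_semiring = lukasiewicz_near_semiring +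
  assumes orthomodular: "x = x \<odot> (x \<oplus> y)"

definition sasaki_projection :: "'a::orthomodular_lattice \<Rightarrow> 'a \<Rightarrow> 'a"
  where "sasaki_projection x y = inf (sup x (- y)) y"

end

theory Submission
  imports Defs
begin

text \<open>For fixed \<^term>\<open>z\<close>, the Sasaki projection onto \<^term>\<open>z\<close> is left adjoint to the Sasaki hook
  \<^term>\<open>\<lambda>w. sup (- z) (inf z w)\<close>; hence it preserves joins, which is right distributivity.
  The other nontrivial identities reduce to the fact that the projection onto \<^term>\<open>z\<close> fixes
  every element below \<^term>\<open>z\<close>: both sides of the Lukasiewicz identity equal the
  meet of the complements.\<close>

text \<open>The orthomodular law for \<open>- z\<close> \<le> \<open>- x\<close>,
  complemented.\<close>

lemma sasaki_projection_absorb: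
  fixes x z :: "'a::orthomodular_lattice"
  assumes "x \<le> z"
  shows "sasaki_projection x z = x"
proof -
  have "sup (- z) (inf z (- x)) = - x"
    using orthomodular[of "- z" "- x"] assms by simp
  then have "- sup (- z) (inf z (- x)) = x"
    by simp
  then show ?thesis
    by (simp add: sasaki_projection_def compl_sup compl_inf inf_commute sup_commute)
qed

text \<open>Both maps are monotone, and the orthomodular law supplies the unit and counit of the
  adjunction.\<close>

lemma sasaki_projection_le_iff:
  fixes x z w :: "'a::orthomodular_lattice"
  shows "sasaki_projection x z \<le> w \<longleftrightarrow> x \<le> sup (- z) (inf z w)"
proof
  assume "sasaki_projection x z \<le> w"
  then have "inf z (sup x (- z)) \<le> inf z w"
    by (simp add: sasaki_projection_def inf_commute)
  then have "sup (- z) (inf z (sup x (- z))) \<le> sup (- z) (inf z w)"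
    by (rule sup_mono[OF order_refl])
  moreover have "sup (- z) (inf z (sup x (- z))) = sup x (- z)"
    using orthomodular[of "- z" "sup x (- z)"] by simp
  ultimately show "x \<le> sup (- z) (inf z w)"
    by simp
next
  assume "x \<le> sup (- z) (inf z w)"
  \<comment> \<open>Joining \<open>- z\<close> turns the bound into the join that the projection of
    \<open>inf z w\<close> meets with \<open>z\<close>.\<close>
  then have "sup x (- z) \<le> sup (inf z w) (- z)"
    by (simp add: sup_commute)
  then have "sasaki_projection x z \<le> sasaki_projection (inf z w) z"
    unfolding sasaki_projection_def by (rule inf_mono) simp
  also have "\<dots> = inf z w"
    by (rule sasaki_projection_absorb) simp
  finally show "sasaki_projection x z \<le> w"
    by simp
qed

lemma sasaki_projection_sup:
  fixes x y z :: "'a::orthomodular_lattice"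
  shows "sasaki_projection (sup x y) z = sup (sasaki_projection x z) (sasaki_projection y z)"
proof (rule order.antisym)
  let ?w = "sup (sasaki_projection x z) (sasaki_projection y z)"
  \<comment> \<open>Read through the adjunction, these only say that each projection lies below
    \<open>?w\<close>.\<close>
  have "x \<le> sup (- z) (inf z ?w)" "y \<le> sup (- z) (inf z ?w)"
    by (simp_all flip: sasaki_projection_le_iff)
  then show "sasaki_projection (sup x y) z \<le> ?w"
    by (simp add: sasaki_projection_le_iff)
  show "?w \<le> sasaki_projection (sup x y) z"
    unfolding sasaki_projection_def by (intro sup_least inf_mono sup_mono) simp_all
qed

lemma sasaki_projection_uminus_sasaki_projection:
  fixes x y :: "'a::orthomodular_lattice"
  shows "sasaki_projection (- sasaki_projection x (- y)) (- y) = inf (- x) (- y)"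
proof -
  \<comment> \<open>By De Morgan the inner complement is \<open>sup (inf (- x) (- y)) y\<close>;
    projecting onto \<open>- y\<close> joins \<open>y\<close> anyway, so this \<open>y\<close> is
    absorbed.\<close>
  have "sasaki_projection (- sasaki_projection x (- y)) (- y)
      = sasaki_projection (inf (- x) (- y)) (- y)"
    by (simp add: sasaki_projection_def compl_sup compl_inf sup_assoc)
  then show ?thesis
    by (simp add: sasaki_projection_absorb)
qed

theorem theorem9:
  shows "orthomodular_near_semiring
    (sup :: 'a::orthomodular_lattice \<Rightarrow> 'a \<Rightarrow> 'a) sasaki_projection uminus bot top"
proof -
  interpret idempotent_near_semiring
    "sup :: 'a \<Rightarrow> 'a \<Rightarrow> 'a" sasaki_projection bot top
  proof
    fix x y z :: 'a
    show "sasaki_projection (sup x y) z = sup (sasaki_projection x z) (sasaki_projection y z)"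
      by (rule sasaki_projection_sup)
  qed (simp_all add: sasaki_projection_def sup_assoc sup_commute)
  have induced_le_iff: "induced_le x y \<longleftrightarrow> x \<le> y" for x y :: 'a
    by (simp add: induced_le_def le_iff_sup)
  show ?thesis
  proof
    fix x y :: 'a
    show "- (- x) = x"
      by simp
    show "induced_le (- y) (- x)" if "induced_le x y"
      using that by (simp add: induced_le_iff)
    show "sasaki_projection (- sasaki_projection x (- y)) (- y)
        = sasaki_projection (- sasaki_projection y (- x)) (- x)"
      by (simp add: sasaki_projection_uminus_sasaki_projection inf_commute)
    \<comment> \<open>The projection fixes \<open>x\<close> because \<open>x\<close> \<le>
      \<open>sup x y\<close>.\<close>
    show "x = sasaki_projection x (sup x y)"
      by (simp add: sasaki_projection_absorb)
  qed
qed

end
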